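(* Let $\alpha>0$ and let $F_\alpha$ be the solution on $[0,\infty)$ of $$F_\alpha'(x)=1-F_\alpha(x)^\alpha,\qquad F_\alpha(0)=0.$$ Then: (i) $F_\alpha$ is an increasing function on $[0,\infty)$ with values in $[0,1)$; (ii) if $\alpha\in(0,1]$, then the function $\widetilde{F}_\alpha(x)=1-F_\alpha(x)$ is completely monotonic.
   Context: A function $f$ defined on $[0,+\infty)$ is called completely monotonic if it is continuous on $[0,\infty)$, infinitely differentiable on $(0,\infty)$, and $(-1)^k f^{(k)}(x)\ge 0$ for all $x>0$ and all integers $k\ge0$. *)

theory Defs
  imports "HOL-Analysis.Analysis"
begin

text \<open>
  Functions on the half-line are total functions on the reals whose values on the negative
  axis are arbitrary. The iterated derivatives are only evaluated on the open half-line,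
  where they do not depend on those values.
\<close>

definition completely_monotonic :: "(real \<Rightarrow> real) \<Rightarrow> bool" where
  "completely_monotonic f \<longleftrightarrow>
     continuous_on {0..} f \<and>
     (\<forall>k::nat. (deriv ^^ k) f differentiable_on {0<..}) \<and>
     (\<forall>k::nat. \<forall>x>0. (-1) ^ k * (deriv ^^ k) f x \<ge> 0)"

text \<open>
  \<open>F\<close> solves the initial value problem on the half-line; at \<open>0\<close> the derivative is one-sided.
  Nonnegativity of \<open>F\<close>, needed for the real power to have its usual meaning, is not part of
  the definition: since \<open>\<alpha> > 0\<close>, the right-hand side equals 1 wherever \<open>F\<close> vanishes, so a
  function starting at 0 cannot become negative, whatever values \<open>powr\<close> takes at negative
  bases.
\<close>

definition solves_ivp :: "real \<Rightarrow> (real \<Rightarrow> real) \<Rightarrow> bool" where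
  "solves_ivp \<alpha> F \<longleftrightarrow>
     F 0 = 0 \<and>
     (\<forall>x\<ge>0. (F has_real_derivative (1 - F x powr \<alpha>)) (at x within {0..}))"

end

theory Submission
  imports Defs
begin

text \<open>
  At every zero of a solution \<open>F\<close> the derivative is 1, so \<open>F\<close> cannot become negative, and a
  one-sided Gronwall argument for \<open>(1 - F x) * exp (L * x)\<close> shows that \<open>F\<close> cannot reach 1.
  Hence \<open>F' > 0\<close>. For \<open>\<alpha> \<le> 1\<close>, a class of nonnegative functions on \<open>(0, 1)\<close> that contains
  \<open>1 - v\<close> and \<open>1 - v powr \<alpha>\<close> and is closed under products and under \<open>- d/dv\<close> also contains,
  by the chain rule, functions \<open>f\<^sub>k\<close> with \<open>(-1)\<^sup>k (1 - F)\<^bsup>(k)\<^esup> = f\<^sub>k \<circ> F\<close>: take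
  \<open>f\<^sub>k\<^sub>+\<^sub>1 v = - f\<^sub>k' v * (1 - v powr \<alpha>)\<close>.
\<close>

text \<open>By convexity the graph of \<open>u powr a\<close> lies above its tangent at 1. Here this
  is read off from \<open>v powr a - a * v\<close>, whose derivative
  \<open>a * (v powr (a - 1) - 1)\<close> is nonpositive on (0, 1]. The derivative rule needs a
  positive base, so \<open>u = 0\<close> is split off.\<close>

lemma one_minus_powr_le:
  fixes u a :: real
  assumes "0 \<le> u" "u \<le> 1" "a \<ge> 1"
  shows "1 - u powr a \<le> a * (1 - u)"
proof (cases "u = 0")
  case False
  then have u: "u > 0" using assms by simp
  have "u powr a - a * u \<ge> 1 powr a - a * 1"
  proof (rule DERIV_nonpos_imp_nonincreasing[OF assms(2)])
    fix x :: real assume x: "u \<le> x" "x \<le> 1"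
    then have "DERIV (\<lambda>v. v powr a - a * v) x :> a * x powr (a - 1) - a"
      using u by (auto intro!: derivative_eq_intros)
    moreover have "a * x powr (a - 1) - a \<le> 0"
      using assms u x by (simp add: powr_le1)
    ultimately show "\<exists>y. DERIV (\<lambda>v. v powr a - a * v) x :> y \<and> y \<le> 0" by blast
  qed
  then show ?thesis by (simp add: algebra_simps)
qed (use assms in auto)

text \<open>On [0, 1], lowering the exponent raises the power, so exponents below 1 reduce to
  exponent 1. This is a Lipschitz-type bound anchored at 1 only; for \<open>a < 1\<close> the power
  is not Lipschitz near 0.\<close>

lemma one_minus_powr_le_max:
  fixes u a :: real
  assumes "0 \<le> u" "u \<le> 1"
  shows "1 - u powr a \<le> max 1 a * (1 - u)"
proof -
  have "u powr max 1 a \<le> u powr a"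
    using assms by (intro powr_mono') auto
  then show ?thesis
    using one_minus_powr_le[OF assms, of "max 1 a"] by simp
qed

context
  fixes \<alpha> :: real and F :: "real \<Rightarrow> real"
  assumes pos: "\<alpha> > 0" and ivp: "solves_ivp \<alpha> F"
begin

lemma ivp_zero: "F 0 = 0"
  using ivp by (simp add: solves_ivp_def)

lemma ivp_DERIV_within:
  "x \<ge> 0 \<Longrightarrow> (F has_real_derivative (1 - F x powr \<alpha>)) (at x within {0..})"
  using ivp by (simp add: solves_ivp_def)

lemma ivp_DERIV:
  assumes "x > 0"
  shows "(F has_real_derivative (1 - F x powr \<alpha>)) (at x)"
proof -
  have "at x within {0..} = at x"
    using assms by (intro at_within_interior) auto
  then show ?thesis using ivp_DERIV_within[of x] assms by simp
qed

lemma ivp_continuous: "continuous_on {0..} F"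
  by (rule DERIV_continuous_on[OF ivp_DERIV_within]) auto

lemma ivp_continuous_Icc: "a \<ge> 0 \<Longrightarrow> continuous_on {a..b} F"
  by (rule continuous_on_subset[OF ivp_continuous]) auto

lemma compact_ivp_superlevel: "compact {x \<in> {0..b}. c \<le> F x}"
proof -
  have "closed {x \<in> {0..b}. c \<le> F x}"
    by (intro continuous_on_closed_Collect_le continuous_on_const ivp_continuous_Icc) auto
  moreover have "bounded {x \<in> {0..b}. c \<le> F x}"
    by (rule bounded_subset[OF bounded_closed_interval]) auto
  ultimately show ?thesis by (simp add: compact_eq_bounded_closed)
qed

lemma ivp_nonneg:
  assumes "c \<ge> 0"
  shows "F c \<ge> 0"
proof (rule ccontr)
  assume neg: "\<not> F c \<ge> 0"
  \<comment> \<open>The last point \<open>s\<close> of \<open>K\<close> will be a zero of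
    \<open>F\<close>; since the slope there is 1, \<open>F\<close> is positive just after
    \<open>s\<close>, which contradicts maximality.\<close>
  define K where "K = {x \<in> {0..c}. 0 \<le> F x}"
  have "compact K" "0 \<in> K"
    using compact_ivp_superlevel assms ivp_zero by (auto simp: K_def)
  then obtain s where s: "s \<in> K" "\<And>t. t \<in> K \<Longrightarrow> t \<le> s"
    using compact_attains_sup[of K] by auto
  have "s \<noteq> c" using s(1) neg by (auto simp: K_def)
  then have sc: "0 \<le> s" "s < c" using s(1) by (auto simp: K_def)
  obtain t where "s \<le> t" "t \<le> c" "F t = 0"
    using IVT2'[of F c 0 s] neg sc s(1) ivp_continuous_Icc[of s c] by (auto simp: K_def)
  moreover from this have "t = s"
    using s(2)[of t] sc by (auto simp: K_def)
  ultimately have "F s = 0" by simp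
  \<comment> \<open>As \<open>0 powr \<alpha> = 0\<close>, the slope at \<open>s\<close> is 1. The
    right-sided criterion also covers \<open>s = 0\<close>, where only a one-sided derivative is
    given.\<close>
  then obtain d where d: "d > 0" "\<And>h. h > 0 \<Longrightarrow> s + h \<in> {0..} \<Longrightarrow> h < d \<Longrightarrow> F s < F (s + h)"
    using has_real_derivative_pos_inc_right[OF ivp_DERIV_within[OF sc(1)]] by auto
  define h where "h = min (d / 2) (c - s)"
  have h: "h > 0" "h < d" "s + h \<le> c" using d(1) sc by (auto simp: h_def)
  then have "s + h \<in> K"
    using d(2)[of h] sc \<open>F s = 0\<close> by (auto simp: K_def)
  then show False using s(2) h(1) by fastforce
qed

lemma ivp_less_1:
  assumes "c \<ge> 0"
  shows "F c < 1"
proof (rule ccontr)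
  assume ge: "\<not> F c < 1"
  \<comment> \<open>The first point \<open>s\<close> of \<open>K\<close> is used: before it
    \<open>F\<close> stays in [0, 1], where the power bound applies.\<close>
  define K where "K = {x \<in> {0..c}. 1 \<le> F x}"
  have "compact K" "c \<in> K"
    using compact_ivp_superlevel assms ge by (auto simp: K_def)
  then obtain s where s: "s \<in> K" "\<And>t. t \<in> K \<Longrightarrow> s \<le> t"
    using compact_attains_inf[of K] by auto
  have "s \<noteq> 0" using s(1) ivp_zero by (auto simp: K_def)
  then have s_pos: "s > 0" and Fs: "F s \<ge> 1" using s(1) by (auto simp: K_def)
  have below: "F t \<le> 1" if "0 < t" "t < s" for t
    using s(2)[of t] s(1) that by (force simp: K_def)
  define L where "L = max 1 \<alpha>"
  \<comment> \<open>The weight \<open>exp (L * t)\<close> turns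
    \<open>1 - F t powr \<alpha> \<le> L * (1 - F t)\<close> into monotonicity. The product starts
    at 1, so it cannot be nonpositive at \<open>s\<close>.\<close>
  have "(1 - F 0) * exp (L * 0) \<le> (1 - F s) * exp (L * s)"
  proof (rule DERIV_nonneg_imp_increasing_open[of 0 s])
    fix t assume t: "0 < t" "t < s"
    let ?D = "(L * (1 - F t) - (1 - F t powr \<alpha>)) * exp (L * t)"
    have "DERIV (\<lambda>t. (1 - F t) * exp (L * t)) t :> ?D"
      by (auto intro!: derivative_eq_intros ivp_DERIV t simp: algebra_simps)
    moreover have "?D \<ge> 0"
      using one_minus_powr_le_max[OF ivp_nonneg below[OF t], of \<alpha>] t by (simp add: L_def)
    ultimately show "\<exists>y. DERIV (\<lambda>t. (1 - F t) * exp (L * t)) t :> y \<and> y \<ge> 0" by blast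
  qed (use s_pos ivp_continuous_Icc in \<open>auto intro!: continuous_intros\<close>)
  then have "(1 - F s) * exp (L * s) \<ge> 1" by (simp add: ivp_zero)
  moreover have "(1 - F s) * exp (L * s) \<le> 0"
    using Fs by (simp add: mult_nonpos_nonneg)
  ultimately show False by simp
qed

lemma ivp_strict_mono: "strict_mono_on {0..} F"
proof (rule strict_mono_onI)
  fix x y :: real assume xy: "x \<in> {0..}" "y \<in> {0..}" "x < y"
  show "F x < F y"
  proof (rule DERIV_pos_imp_increasing_open[OF xy(3)])
    fix t assume t: "x < t" "t < y"
    then have "t > 0" using xy by simp
    moreover have "F t powr \<alpha> < 1"
      using powr_less_mono2[of \<alpha> "F t" 1] ivp_nonneg[of t] ivp_less_1[of t] pos \<open>t > 0\<close> by simp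
    ultimately show "\<exists>d. DERIV F t :> d \<and> d > 0"
      using ivp_DERIV by fastforce
  qed (use ivp_continuous_Icc xy in auto)
qed

lemma ivp_pos: "x > 0 \<Longrightarrow> F x > 0"
  using strict_mono_onD[OF ivp_strict_mono, of 0 x] ivp_zero by simp

end

text \<open>Generating the class from explicit functions reduces closure under \<open>- d/dv\<close>
  to a check on generators. The bound \<open>a \<le> 1\<close> makes
  \<open>a * v powr (a - 1)\<close> a nonnegative constant times a power with nonpositive exponent,
  hence again a member.\<close>

inductive derivs_alternate :: "(real \<Rightarrow> real) \<Rightarrow> bool" where
  const: "c \<ge> 0 \<Longrightarrow> derivs_alternate (\<lambda>v. c)"
| one_minus_powr: "0 \<le> a \<Longrightarrow> a \<le> 1 \<Longrightarrow> derivs_alternate (\<lambda>v. 1 - v powr a)"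
| powr: "b \<le> 0 \<Longrightarrow> derivs_alternate (\<lambda>v. v powr b)"
| add: "derivs_alternate f \<Longrightarrow> derivs_alternate g \<Longrightarrow> derivs_alternate (\<lambda>v. f v + g v)"
| mult: "derivs_alternate f \<Longrightarrow> derivs_alternate g \<Longrightarrow> derivs_alternate (\<lambda>v. f v * g v)"

lemma derivs_alternate_nonneg:
  "derivs_alternate f \<Longrightarrow> 0 < v \<Longrightarrow> v < 1 \<Longrightarrow> f v \<ge> 0"
  by (induction rule: derivs_alternate.induct) (auto simp: powr_le1)

lemma derivs_alternate_DERIV:
  assumes "derivs_alternate f"
  shows "\<exists>g. derivs_alternate g \<and> (\<forall>v>0. DERIV f v :> - g v)"
  using assms
proof induction
  case (const c)
  show ?case
    by (rule exI[of _ "\<lambda>v. 0"]) (auto intro: derivs_alternate.const)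
next
  case (one_minus_powr a)
  then show ?case
    by (intro exI[of _ "\<lambda>v. a * v powr (a - 1)"])
      (auto intro!: derivs_alternate.mult derivs_alternate.const derivs_alternate.powr
        derivative_eq_intros)
next
  case (powr b)
  have "derivs_alternate (\<lambda>v. (- b) * v powr (b - 1))"
    using powr by (intro derivs_alternate.mult derivs_alternate.const derivs_alternate.powr) auto
  moreover have "\<forall>v>0. DERIV (\<lambda>v. v powr b) v :> - ((- b) * v powr (b - 1))"
    by (auto intro!: derivative_eq_intros)
  ultimately show ?case by blast
next
  case (add f g)
  then obtain f' g' where "derivs_alternate f'" "derivs_alternate g'"
    "\<forall>v>0. DERIV f v :> - f' v" "\<forall>v>0. DERIV g v :> - g' v" by blast
  then show ?case
    by (intro exI[of _ "\<lambda>v. f' v + g' v"])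
      (auto intro!: derivs_alternate.add derivative_eq_intros)
next
  case (mult f g)
  then obtain f' g' where "derivs_alternate f'" "derivs_alternate g'"
    "\<forall>v>0. DERIV f v :> - f' v" "\<forall>v>0. DERIV g v :> - g' v" by blast
  with mult.hyps show ?case
    \<comment> \<open>Product rule with the signs absorbed: if \<open>f'\<close> and
      \<open>g'\<close> are the negated derivatives, so is this sum for the product.\<close>
    by (intro exI[of _ "\<lambda>v. f' v * g v + f v * g' v"])
      (auto intro!: derivs_alternate.add derivs_alternate.mult derivative_eq_intros
        simp: algebra_simps)
qed

text \<open>Differentiation is local and the half-line is open, so a formula valid only for positive
  arguments may be differentiated.\<close>

lemma funpow_deriv_has_derivative:
  fixes G g :: "real \<Rightarrow> real"
  assumes "\<And>x. x > 0 \<Longrightarrow> (deriv ^^ k) G x = g x"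
    and "x > 0" "DERIV g x :> d"
  shows "DERIV ((deriv ^^ k) G) x :> d"
  by (rule has_field_derivative_transform_within_open[OF assms(3), of "{0<..}"])
    (use assms in auto)

lemma ivp_funpow_deriv:
  assumes "\<alpha> > 0" "solves_ivp \<alpha> F" "\<alpha> \<le> 1"
  shows "\<exists>f. derivs_alternate f \<and> (\<forall>x>0. (deriv ^^ k) (\<lambda>x. 1 - F x) x = (- 1) ^ k * f (F x))"
proof (induction k)
  case 0
  \<comment> \<open>Exponent 1 makes \<open>1 - v\<close> an instance of a generator; the two agree
    at the positive values \<open>F x\<close>.\<close>
  have "derivs_alternate (\<lambda>v. 1 - v powr 1)"
    by (intro derivs_alternate.one_minus_powr) auto
  moreover have "\<forall>x>0. (deriv ^^ 0) (\<lambda>x. 1 - F x) x = (- 1) ^ 0 * (1 - F x powr 1)"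
    using ivp_pos[OF assms(1,2)] by (simp add: less_imp_le)
  ultimately show ?case by (intro exI[of _ "\<lambda>v. 1 - v powr 1"] conjI)
next
  case (Suc k)
  then obtain f where f: "derivs_alternate f"
    "\<And>x. x > 0 \<Longrightarrow> (deriv ^^ k) (\<lambda>x. 1 - F x) x = (- 1) ^ k * f (F x)" by blast
  from derivs_alternate_DERIV[OF f(1)] obtain g where g: "derivs_alternate g"
    "\<And>v. v > 0 \<Longrightarrow> DERIV f v :> - g v" by blast
  have "(deriv ^^ Suc k) (\<lambda>x. 1 - F x) x = (- 1) ^ Suc k * (g (F x) * (1 - F x powr \<alpha>))"
    if "x > 0" for x
  proof -
    \<comment> \<open>The differential equation expresses the inner derivative through
      \<open>F x\<close> itself, so the result is again a function of \<open>F x\<close>; the minus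
      sign of \<open>- g\<close> supplies the next factor of \<open>(- 1) ^ Suc k\<close>.\<close>
    have "DERIV (\<lambda>x. f (F x)) x :> - g (F x) * (1 - F x powr \<alpha>)"
      by (rule DERIV_chain2[OF g(2)[OF ivp_pos[OF assms(1,2) that]] ivp_DERIV[OF assms(1,2) that]])
    then have "DERIV (\<lambda>x. (- 1) ^ k * f (F x)) x :> (- 1) ^ k * (- g (F x) * (1 - F x powr \<alpha>))"
      by (rule DERIV_cmult)
    from funpow_deriv_has_derivative[OF f(2) that this] show ?thesis
      by (simp add: DERIV_imp_deriv)
  qed
  moreover have "derivs_alternate (\<lambda>v. g v * (1 - v powr \<alpha>))"
    using assms by (intro derivs_alternate.mult g derivs_alternate.one_minus_powr) auto
  ultimately show ?case by (intro exI[of _ "\<lambda>v. g v * (1 - v powr \<alpha>)"]) simp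
qed

lemma ivp_completely_monotonic:
  assumes "\<alpha> > 0" "solves_ivp \<alpha> F" "\<alpha> \<le> 1"
  shows "completely_monotonic (\<lambda>x. 1 - F x)"
  unfolding completely_monotonic_def
proof (intro conjI allI impI)
  show "continuous_on {0..} (\<lambda>x. 1 - F x)"
    by (intro continuous_intros ivp_continuous[OF assms(1,2)])
next
  fix k :: nat
  obtain f where f: "derivs_alternate f"
    "\<And>x. x > 0 \<Longrightarrow> (deriv ^^ k) (\<lambda>x. 1 - F x) x = (- 1) ^ k * f (F x)"
    using ivp_funpow_deriv[OF assms] by blast
  from derivs_alternate_DERIV[OF f(1)] obtain g where g:
    "\<And>v. v > 0 \<Longrightarrow> DERIV f v :> - g v" by blast
  show "(deriv ^^ k) (\<lambda>x. 1 - F x) differentiable_on {0<..}"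
    unfolding differentiable_on_def
  proof
    fix x :: real assume "x \<in> {0<..}"
    then have x: "x > 0" by simp
    have "DERIV (\<lambda>x. (- 1) ^ k * f (F x)) x :> (- 1) ^ k * (- g (F x) * (1 - F x powr \<alpha>))"
      by (intro DERIV_cmult
          DERIV_chain2[OF g[OF ivp_pos[OF assms(1,2) x]] ivp_DERIV[OF assms(1,2) x]])
    from funpow_deriv_has_derivative[OF f(2) x this]
    show "(deriv ^^ k) (\<lambda>x. 1 - F x) differentiable (at x within {0<..})"
      by (auto simp: real_differentiable_def intro: has_field_derivative_at_within)
  qed
  fix x :: real assume "x > 0"
  then show "0 \<le> (- 1) ^ k * (deriv ^^ k) (\<lambda>x. 1 - F x) x"
    using derivs_alternate_nonneg[OF f(1) ivp_pos[OF assms(1,2)] ivp_less_1[OF assms(1,2)]] f(2)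
    \<comment> \<open>The two factors \<open>(- 1) ^ k\<close> cancel, leaving
      \<open>f (F x)\<close> with \<open>F x\<close> in (0, 1).\<close>
    by (simp flip: mult.assoc power_mult_distrib)
qed

theorem theorem4p1:
  fixes \<alpha> :: real and F :: "real \<Rightarrow> real"
  assumes "\<alpha> > 0" and "solves_ivp \<alpha> F"
  shows "strict_mono_on {0..} F \<and> F ` {0..} \<subseteq> {0..<1} \<and>
         (\<alpha> \<le> 1 \<longrightarrow> completely_monotonic (\<lambda>x. 1 - F x))"
  using ivp_strict_mono[OF assms] ivp_nonneg[OF assms] ivp_less_1[OF assms]
    ivp_completely_monotonic[OF assms] by auto

end
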